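(* Let $p\ge0$ be an integer. There exist constants $c_p$ and $d_p$ such that the following holds. Let $Q\in W_\infty^p[0,b]$ and $h\in\mathbb{C}$, let $K$ be the associated transmutation kernel, $K_1=\partial_xK$, and let $K_N$, $K_{1,N}$ be the partial sums of the Fourier–Legendre series of $K$ and $K_1$, and $M$, $M_1$ the suprema, all as defined in the context. Then for all $x\in(0,b]$ $$\|K(x,\cdot)-K_N(x,\cdot)\|_{L_2(-x,x)}\le\frac{c_pMx^{p+3/2}}{N^{p+1}},\qquad N\ge p+2,$$ and $$\|K_1(x,\cdot)-K_{1,N}(x,\cdot)\|_{L_2(-x,x)}\le\frac{d_pM_1x^{p+1/2}}{N^p},\qquad N\ge p+1.$$ The constants $c_p$ and $d_p$ are independent of $Q$ and $N$.
   Context: $b>0$ is finite. $Q\in W_\infty^p[0,b]$ means that the (in general complex-valued) function $Q$ possesses $p$ derivatives, the last one belonging to $L_\infty(0,b)$ ($W^0_\infty=L_\infty$). For $\omega\in\mathbb{C}$ let $c(\omega,x)$, $s(\omega,x)$ be the solutions of $u''-Q(x)u=-\omega^2u$ on $(0,b)$ with $c(\omega,0)=1$, $c'(\omega,0)=h$, $s(\omega,0)=0$, $s'(\omega,0)=\omega$. The transmutation kernel $K(x,t)$, $0\le x\le b$, $|t|\le x$, is the (well-known) function, independent of $\omega$, for which $$c(\omega,x)=\cos\omega x+\int_{-x}^xK(x,t)\cos\omega t\,dt,\qquad s(\omega,x)=\sin\omega x+\int_{-x}^xK(x,t)\sin\omega t\,dt$$ for all $\omega\in\mathbb{C}$. It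 satisfies $K(x,x)=\frac h2+\frac12\int_0^xQ(s)\,ds$ and $K(x,-x)=\frac h2$, and it possesses $p+1$ derivatives with respect to each variable when $Q\in W^p_\infty[0,b]$. With $P_j$ the classical Legendre polynomials, set $$\beta_j(x)=\frac{2j+1}2\int_{-x}^xK(x,t)P_j\left(\frac tx\right)dt,\qquad \gamma_j(x)=\frac{2j+1}2\int_{-x}^xK_1(x,t)P_j\left(\frac tx\right)dt,$$ $$K_N(x,t)=\sum_{j=0}^N\frac{\beta_j(x)}xP_j\left(\frac tx\right),\qquad K_{1,N}(x,t)=\sum_{j=0}^N\frac{\gamma_j(x)}xP_j\left(\frac tx\right).$$ Finally, $$M=\sup_{0<x\le b}\|\partial_t^{p+1}K(x,\cdot)\|_{L_\infty(-x,x)},\qquad M_1=\sup_{0<x\le b}\|\partial_t^pK_1(x,\cdot)\|_{L_\infty(-x,x)},$$ both of which are finite. *)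

theory Defs
  imports
    "HOL-Analysis.Analysis"
    "HOL-Probability.Essential_Supremum"
    "HOL-Computational_Algebra.Polynomial"
begin

definition Linf_norm :: "real \<Rightarrow> real \<Rightarrow> (real \<Rightarrow> complex) \<Rightarrow> ennreal" where
  "Linf_norm a b f = esssup (lebesgue_on {a..b}) (\<lambda>t. ennreal (norm (f t)))"

definition L2_norm :: "real \<Rightarrow> real \<Rightarrow> (real \<Rightarrow> complex) \<Rightarrow> ennreal" where
  "L2_norm a b f =
     (let I = (\<integral>\<^sup>+t. ennreal ((norm (f t))\<^sup>2) \<partial>lebesgue_on {a..b})
      in if I = \<infinity> then \<infinity> else ennreal (sqrt (enn2real I)))"

(* nth_weak_deriv k a b f g: g is the k-th derivative of f on (a, b) in the Sobolev sense. The
   derivatives of order less than k are absolutely continuous after a change on a null set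
   (an absolutely continuous function being an indefinite Lebesgue integral), and g is
   determined up to a null set. *)
primrec nth_weak_deriv ::
  "nat \<Rightarrow> real \<Rightarrow> real \<Rightarrow> (real \<Rightarrow> complex) \<Rightarrow> (real \<Rightarrow> complex) \<Rightarrow> bool" where
  "nth_weak_deriv 0 a b f g \<longleftrightarrow>
     g absolutely_integrable_on {a..b} \<and> (AE t in lebesgue_on {a..b}. f t = g t)"
| "nth_weak_deriv (Suc k) a b f g \<longleftrightarrow>
     (\<exists>f' C. f' absolutely_integrable_on {a..b} \<and>
        (AE t in lebesgue_on {a..b}. f t = C + integral {a..t} f') \<and>
        nth_weak_deriv k a b f' g)"

definition W_inf :: "nat \<Rightarrow> real \<Rightarrow> real \<Rightarrow> (real \<Rightarrow> complex) set" where
  "W_inf p a b = {Q. \<exists>g. nth_weak_deriv p a b Q g \<and> Linf_norm a b g < \<infinity>}"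

(* The essential supremum of the k-th derivative. The infimum is over almost everywhere equal
   functions g, so it only serves to give the usual value \<infinity> when there is no such derivative. *)
definition deriv_Linf_norm :: "nat \<Rightarrow> real \<Rightarrow> real \<Rightarrow> (real \<Rightarrow> complex) \<Rightarrow> ennreal" where
  "deriv_Linf_norm k a b f = (INF g \<in> {g. nth_weak_deriv k a b f g}. Linf_norm a b g)"

(* u'' - Q u = -\<omega>^2 u on (0, b), u(0) = u0, u'(0) = u1, in the Caratheodory sense: since Q is
   only in L_infinity when p = 0, the derivative v = u' is absolutely continuous and the equation
   holds almost everywhere, i.e. v is the indefinite integral of (Q - \<omega>^2) u. *)
definition schrodinger_ivp ::
  "real \<Rightarrow> (real \<Rightarrow> complex) \<Rightarrow> complex \<Rightarrow> complex \<Rightarrow> complex \<Rightarrow> (real \<Rightarrow> complex) \<Rightarrow> bool" where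
  "schrodinger_ivp b Q \<omega> u0 u1 u \<longleftrightarrow>
     u 0 = u0 \<and>
     (\<lambda>y. (Q y - \<omega>\<^sup>2) * u y) absolutely_integrable_on {0..b} \<and>
     (\<exists>v. \<forall>x\<in>{0..b}.
        (u has_vector_derivative v x) (at x within {0..b}) \<and>
        v x = u1 + integral {0..x} (\<lambda>y. (Q y - \<omega>\<^sup>2) * u y))"

(* The functions c and s are the unique solutions of their initial value problems on [0, b].
   For each x the representations determine K(x, .) up to a null set; continuity on the closed
   triangle selects the representative. *)
definition transmutation_kernel ::
  "real \<Rightarrow> (real \<Rightarrow> complex) \<Rightarrow> complex \<Rightarrow> (real \<Rightarrow> real \<Rightarrow> complex) \<Rightarrow> bool" where
  "transmutation_kernel b Q h K \<longleftrightarrow>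
     continuous_on {(x, t). 0 \<le> x \<and> x \<le> b \<and> \<bar>t\<bar> \<le> x} (\<lambda>(x, t). K x t) \<and>
     (\<forall>\<omega>. \<exists>c s.
        schrodinger_ivp b Q \<omega> 1 h c \<and> schrodinger_ivp b Q \<omega> 0 \<omega> s \<and>
        (\<forall>x\<in>{0..b}.
           c x = cos (\<omega> * of_real x) + integral {-x..x} (\<lambda>t. K x t * cos (\<omega> * of_real t)) \<and>
           s x = sin (\<omega> * of_real x) + integral {-x..x} (\<lambda>t. K x t * sin (\<omega> * of_real t))))"

(* The partial derivative of K in x, taken within the triangle (hence one-sided at x = b). For
   p = 0 it exists, for each x, only for almost every t. *)
definition kernel_dx ::
  "real \<Rightarrow> (real \<Rightarrow> real \<Rightarrow> complex) \<Rightarrow> real \<Rightarrow> real \<Rightarrow> complex" where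
  "kernel_dx b K x t = vector_derivative (\<lambda>y. K y t) (at x within {\<bar>t\<bar>..b})"

(* Rodrigues' formula *)
definition legendre_poly :: "nat \<Rightarrow> real poly" where
  "legendre_poly j = smult (1 / (2 ^ j * fact j)) ((pderiv ^^ j) ([:-1, 0, 1:] ^ j))"

(* With F = K this is \<beta>_j(x), with F = kernel_dx b K it is \<gamma>_j(x). *)
definition legendre_coeff :: "(real \<Rightarrow> real \<Rightarrow> complex) \<Rightarrow> nat \<Rightarrow> real \<Rightarrow> complex" where
  "legendre_coeff F j x =
     of_real ((2 * real j + 1) / 2) *
     integral {-x..x} (\<lambda>t. F x t * of_real (poly (legendre_poly j) (t / x)))"

definition legendre_partial_sum ::
  "(real \<Rightarrow> real \<Rightarrow> complex) \<Rightarrow> nat \<Rightarrow> real \<Rightarrow> real \<Rightarrow> complex" where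
  "legendre_partial_sum F N x t =
     (\<Sum>j\<le>N. legendre_coeff F j x / of_real x * of_real (poly (legendre_poly j) (t / x)))"

(* With k = p + 1 and F = K this is M, with k = p and F = kernel_dx b K it is M_1. *)
definition sup_dt_Linf_norm :: "nat \<Rightarrow> real \<Rightarrow> (real \<Rightarrow> real \<Rightarrow> complex) \<Rightarrow> ennreal" where
  "sup_dt_Linf_norm k b F = (SUP x\<in>{0<..b}. deriv_Linf_norm k (-x) x (F x))"

end

theory Submission
  imports Defs
begin

text \<open>For each \<open>x\<close> the claim is a Jackson inequality for a single function on \<open>[-x, x]\<close>
  with a bounded weak derivative of order \<open>k\<close>. The Legendre partial sum is the best mean-square approximation of its degree, so some good polynomial has to be found. For
  \<open>k = 1\<close>, Legendre's differential equation and integration by parts turn the tail of the Legendre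
  series of \<open>f\<close> into an orthogonal expansion of \<open>f'\<close>, and the Weierstrass theorem supplies
  completeness; the error for degree \<open>N\<close> is at most \<open>x / (N + 1)\<close> times the norm of \<open>f'\<close>. For larger
  \<open>k\<close>, subtract from \<open>f\<close> an antiderivative of a good approximation of \<open>f'\<close> of degree \<open>N - 1\<close> and
  apply the case \<open>k = 1\<close> to the difference. Complex functions are split into real and imaginary
  parts.\<close>

subsection \<open>Integrals of polynomials\<close>

text \<open>A functional on polynomials, so that the algebra of orthogonality takes place on the
  reference interval; [-x, x] enters later through the scaling \<open>t / x\<close>.\<close>

definition pint :: "real poly \<Rightarrow> real" where
  "pint p = integral {-1..1} (poly p)"

lemma poly_integrable: "poly (p :: real poly) integrable_on {a..b}"
  by (intro integrable_continuous_real continuous_intros)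

lemma has_integral_pint: "(poly p has_integral pint p) {-1..1}"
  using poly_integrable by (simp add: pint_def integrable_integral)

lemma pint_unique: "(f has_integral I) {-1..1} \<Longrightarrow> (\<And>t. f t = poly p t) \<Longrightarrow> pint p = I"
  unfolding pint_def by (rule integral_unique) (metis has_integral_cong)

lemma pint_0 [simp]: "pint 0 = 0"
  by (rule pint_unique[OF has_integral_0]) simp

lemma pint_add: "pint (p + q) = pint p + pint q"
  by (rule pint_unique[OF has_integral_add[OF has_integral_pint has_integral_pint]]) simp

lemma pint_smult: "pint (smult c p) = c * pint p"
  by (rule pint_unique[OF has_integral_mult_right[OF has_integral_pint]]) simp

lemma pint_sum: "pint (sum f A) = (\<Sum>i\<in>A. pint (f i))"
  by (induction A rule: infinite_finite_induct) (simp_all add: pint_add)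

lemma pint_pderiv: "pint (pderiv p) = poly p 1 - poly p (-1)"
proof -
  have "(poly (pderiv p) has_integral poly p 1 - poly p (-1)) {-1..1}"
    by (rule fundamental_theorem_of_calculus)
       (auto simp flip: has_real_derivative_iff_has_vector_derivative
             intro: DERIV_subset[OF poly_DERIV])
  then show ?thesis
    by (simp add: pint_def integral_unique)
qed

lemma pint_by_parts:
  assumes "poly (p * q) 1 = poly (p * q) (-1)"
  shows "pint (p * pderiv q) = - pint (pderiv p * q)"
proof -
  have "pint (p * pderiv q) + pint (q * pderiv p) = 0"
    using assms pint_pderiv[of "p * q"] by (simp only: pderiv_mult pint_add)
  then show ?thesis
    by (simp add: mult.commute)
qed

text \<open>The degree bound lets an approximation of a derivative be lifted to one of the function
  at the cost of one degree.\<close>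

lemma ex_antiderivative: "\<exists>q :: real poly. pderiv q = p \<and> degree q \<le> Suc (degree p)"
proof -
  define q where "q = (\<Sum>i\<le>degree p. monom (coeff p i / real (Suc i)) (Suc i))"
  have "pderiv q = (\<Sum>i\<le>degree p. monom (coeff p i) i)"
    unfolding q_def higher_pderiv_sum[of 1, simplified] by (intro sum.cong refl) (simp add: pderiv_monom)
  then have "pderiv q = p"
    by (simp add: poly_as_sum_of_monoms)
  moreover have "degree q \<le> Suc (degree p)"
    unfolding q_def by (intro degree_sum_le) (auto intro: order.trans[OF degree_monom_le])
  ultimately show ?thesis
    by blast
qed

subsection \<open>Legendre polynomials\<close>

definition X :: "real poly" where
  "X = [:0, 1:]"

text \<open>The base of Rodrigues' formula. It is negative inside (-1, 1), so \<open>- quad\<close>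
  is the weight in Legendre's equation.\<close>

definition quad :: "real poly" where
  "quad = [:-1, 0, 1:]"

lemma poly_X [simp]: "poly X t = t"
  by (simp add: X_def)

lemma pderiv_X [simp]: "pderiv X = 1"
  by (simp add: X_def pderiv_pCons)

lemma poly_quad [simp]: "poly quad t = t\<^sup>2 - 1"
  by (simp add: quad_def power2_eq_square)

lemma pderiv_quad [simp]: "pderiv quad = smult 2 X"
  by (simp add: X_def quad_def pderiv_pCons)

lemma X_mult_X: "X * X = quad + 1"
  by (simp add: X_def quad_def one_pCons)

lemma legendre_poly_quad: "legendre_poly n = smult (1 / (2 ^ n * fact n)) ((pderiv ^^ n) (quad ^ n))"
  by (simp add: legendre_poly_def quad_def)

section \<open>Rodrigues' formula, orthogonality and norms\<close>

lemma power_dvd_pderiv: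
  fixes p q :: "real poly"
  assumes "p ^ n dvd q"
  shows "p ^ (n - 1) dvd pderiv q"
proof (cases n)
  case (Suc m)
  from assms obtain r where "q = p ^ n * r"
    by (elim dvdE)
  then have "pderiv q = p ^ m * (p * pderiv r + smult (of_nat (Suc m)) (r * pderiv p))"
    unfolding Suc \<open>q = p ^ n * r\<close> pderiv_mult pderiv_power_Suc
    by (simp add: algebra_simps del: of_nat_Suc)
  then show ?thesis
    by (simp add: Suc)
qed simp

text \<open>Each differentiation costs at most one factor \<open>p\<close>; truncated subtraction
  makes the claim trivial for n \<le> i.\<close>

lemma power_dvd_higher_pderiv:
  fixes p :: "real poly"
  shows "p ^ (n - i) dvd (pderiv ^^ i) (p ^ n)"
proof (induction i)
  case (Suc i)
  then show ?case
    using power_dvd_pderiv[of p "n - i"] by simp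
qed simp

text \<open>Fewer than n derivatives leave a factor \<open>quad\<close>, which vanishes at both end
  points.\<close>

lemma higher_pderiv_quad_power_endpoint:
  assumes "i < n" "a\<^sup>2 = 1"
  shows "poly ((pderiv ^^ i) (quad ^ n)) a = 0"
proof -
  have "quad dvd quad ^ (n - i)"
    using assms(1) by (intro dvd_power) auto
  then have "quad dvd (pderiv ^^ i) (quad ^ n)"
    using power_dvd_higher_pderiv by (rule dvd_trans)
  then obtain r where "(pderiv ^^ i) (quad ^ n) = quad * r"
    by (rule dvdE)
  then show ?thesis
    using assms(2) by simp
qed

text \<open>Integration by parts k times. Each boundary term contains a derivative of
  \<open>quad ^ n\<close> of order below n and vanishes.\<close>

lemma pint_times_higher_pderiv:
  assumes "k \<le> n"
  shows "pint (q * (pderiv ^^ n) (quad ^ n)) =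
           (-1) ^ k * pint ((pderiv ^^ k) q * (pderiv ^^ (n - k)) (quad ^ n))"
  using assms
proof (induction k)
  case (Suc k)
  then have *: "n - k = Suc (n - Suc k)"
    by simp
  have "pint ((pderiv ^^ k) q * (pderiv ^^ (n - k)) (quad ^ n)) =
        - pint ((pderiv ^^ Suc k) q * (pderiv ^^ (n - Suc k)) (quad ^ n))"
    unfolding * funpow.simps comp_def using Suc.prems
    by (intro pint_by_parts) (simp add: higher_pderiv_quad_power_endpoint)
  then show ?case
    using Suc by simp
qed simp

text \<open>The left side is the integral of (1 - t^2)^n, a Beta function value. Integrating by
  parts against \<open>X\<close> and writing \<open>X * X\<close> as \<open>quad + 1\<close> gives a
  recursion in n.\<close>

lemma pint_quad_power: "(-1) ^ n * pint (quad ^ n) = 2 ^ (2 * n + 1) * (fact n)\<^sup>2 / fact (2 * n + 1)"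
proof (induction n)
  case 0
  show ?case
    using pint_pderiv[of X] by simp
next
  case (Suc n)
  have "pint (quad ^ Suc n * pderiv X) = - pint (pderiv (quad ^ Suc n) * X)"
    by (intro pint_by_parts) simp
  also have "quad ^ Suc n * pderiv X = quad ^ Suc n"
    by simp
  also have "pderiv (quad ^ Suc n) * X = smult (2 * (n + 1)) (quad ^ Suc n + quad ^ n)"
  proof -
    have "pderiv quad * X = smult 2 (quad + 1)"
      by (simp add: X_mult_X)
    then have "pderiv (quad ^ Suc n) * X = smult (of_nat (Suc n)) (quad ^ n * smult 2 (quad + 1))"
      by (simp only: pderiv_power_Suc mult_smult_left mult.assoc)
    then show ?thesis
      by (simp add: algebra_simps)
  qed
  finally have "pint (quad ^ Suc n) * (2 * n + 3) = - (2 * (n + 1)) * pint (quad ^ n)"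
    by (simp add: pint_smult pint_add algebra_simps)
  then have "(-1) ^ Suc n * (pint (quad ^ Suc n) * (2 * n + 3)) = (-1) ^ Suc n * (- (2 * (n + 1)) * pint (quad ^ n))"
    by (simp only:)
  then have "(-1) ^ Suc n * pint (quad ^ Suc n) * (2 * n + 3) = 2 * (n + 1) * ((-1) ^ n * pint (quad ^ n))"
    by (simp add: algebra_simps)
  also have "\<dots> = 2 * (n + 1) * (2 ^ (2 * n + 1) * (fact n)\<^sup>2 / fact (2 * n + 1))"
    by (simp only: Suc.IH)
  finally have "(-1) ^ Suc n * pint (quad ^ Suc n) =
      2 * (n + 1) * (2 ^ (2 * n + 1) * (fact n)\<^sup>2 / fact (2 * n + 1)) / (2 * n + 3)"
    by (intro eq_divide_imp) auto
  also have "\<dots> = 2 ^ (2 * Suc n + 1) * (fact (Suc n))\<^sup>2 / fact (2 * Suc n + 1)"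
    by (simp add: divide_simps power2_eq_square del: of_nat_mult of_nat_add) (simp add: algebra_simps)
  finally show ?case .
qed

lemma degree_quad_power: "degree (quad ^ n) = 2 * n"
  by (simp add: degree_power_eq quad_def)

lemma degree_legendre: "degree (legendre_poly n) = n"
  by (simp add: legendre_poly_quad degree_higher_pderiv degree_quad_power)

lemma legendre_0 [simp]: "legendre_poly 0 = 1"
  by (simp add: legendre_poly_def)

text \<open>With all n derivatives moved onto \<open>q\<close>, orthogonality to lower degrees is
  immediate, and the norm needs only the n-th derivative of \<open>legendre_poly n\<close>.\<close>

lemma pint_times_legendre:
  "pint (q * legendre_poly n) = (-1) ^ n * pint ((pderiv ^^ n) q * quad ^ n) / (2 ^ n * fact n)"
  using pint_times_higher_pderiv[of n n q] by (simp add: legendre_poly_quad pint_smult)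

lemma higher_pderiv_eq_0:
  assumes "degree (q :: real poly) < n"
  shows "(pderiv ^^ n) q = 0"
proof -
  obtain m where m: "n = Suc m"
    using assms by (cases n) auto
  have "degree ((pderiv ^^ m) q) = 0"
    using assms by (simp add: degree_higher_pderiv m)
  then show ?thesis
    by (simp add: m pderiv_eq_0_iff)
qed

lemma pint_legendre_orthogonal:
  assumes "degree q < n"
  shows "pint (q * legendre_poly n) = 0"
  by (simp add: pint_times_legendre higher_pderiv_eq_0 assms)

text \<open>Only the leading coefficient counts: \<open>quad ^ n\<close> is monic of degree 2 n, so
  its derivative of order 2 n is the constant (2 n)!.\<close>

lemma higher_pderiv_legendre:
  "(pderiv ^^ n) (legendre_poly n) = [:fact (2 * n) / (2 ^ n * fact n):]"
proof -
  have "degree ((pderiv ^^ (n + n)) (quad ^ n)) = 0"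
    by (simp add: degree_higher_pderiv degree_quad_power)
  then obtain c where c: "(pderiv ^^ (n + n)) (quad ^ n) = [:c:]"
    by (meson degree_eq_zeroE)
  have "lead_coeff (quad ^ n) = 1"
    by (simp add: lead_coeff_power) (simp add: quad_def)
  then have "coeff (quad ^ n) (n + n) = 1"
    by (simp add: degree_quad_power flip: mult_2)
  then have "coeff ((pderiv ^^ (n + n)) (quad ^ n)) 0 = fact (2 * n)"
    unfolding coeff_higher_pderiv by (simp add: pochhammer_fact mult_2)
  then have "c = fact (2 * n)"
    by (simp add: c)
  then show ?thesis
    using c by (simp add: legendre_poly_quad higher_pderiv_smult funpow_add)
qed

lemma pint_legendre_square: "pint (legendre_poly n * legendre_poly n) = 2 / (2 * real n + 1)"
proof -
  have "pint (legendre_poly n * legendre_poly n) =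
      fact (2 * n) / (2 ^ n * fact n)\<^sup>2 * ((-1) ^ n * pint (quad ^ n))"
    by (simp add: pint_times_legendre higher_pderiv_legendre pint_smult power2_eq_square)
  also have "\<dots> = fact (2 * n) / (2 ^ n * fact n)\<^sup>2 *
      (2 ^ (2 * n + 1) * (fact n)\<^sup>2 / fact (2 * n + 1))"
    by (simp only: pint_quad_power)
  also have "\<dots> = 2 / (2 * real n + 1)"
    by (simp add: power_mult_distrib power_mult[symmetric] divide_simps mult.commute[of n 2])
  finally show ?thesis .
qed

lemma pint_legendre:
  "pint (legendre_poly i * legendre_poly j) = (if i = j then 2 / (2 * real j + 1) else 0)"
proof (cases i j rule: linorder_cases)
  case greater
  then show ?thesis
    using pint_legendre_orthogonal[of "legendre_poly j" i] by (simp add: degree_legendre mult.commute)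
qed (simp_all add: pint_legendre_square pint_legendre_orthogonal degree_legendre)

section \<open>Legendre's differential equation\<close>

lemma higher_pderiv_X_mult:
  fixes u :: "real poly"
  shows "(pderiv ^^ Suc m) (X * u) =
    X * (pderiv ^^ Suc m) u + smult (Suc m) ((pderiv ^^ m) u)"
proof (induction m)
  case (Suc m)
  show ?case
    unfolding funpow.simps(2)[of "Suc m"] comp_def Suc.IH
    by (rule poly_ext) (simp add: pderiv_add pderiv_mult pderiv_smult algebra_simps)
qed (simp add: pderiv_mult)

text \<open>Leibniz' rule, which stops after the second derivative of \<open>quad\<close>.\<close>

lemma higher_pderiv_quad_mult:
  "(pderiv ^^ Suc (Suc m)) (quad * u) =
    quad * (pderiv ^^ Suc (Suc m)) u + smult (2 * (m + 2)) (X * (pderiv ^^ Suc m) u)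
    + smult ((m + 1) * (m + 2)) ((pderiv ^^ m) u)"
proof (induction m)
  case 0
  show ?case
    by (rule poly_ext) (simp add: pderiv_mult pderiv_add pderiv_smult algebra_simps)
next
  case (Suc m)
  show ?case
    unfolding funpow.simps(2)[of "Suc (Suc m)"] comp_def Suc.IH
    by (rule poly_ext) (simp add: pderiv_mult pderiv_add pderiv_smult algebra_simps)
qed

lemma legendre_ode:
  "pderiv (quad * pderiv (legendre_poly n)) = smult (real n * (real n + 1)) (legendre_poly n)"
proof (cases n)
  case (Suc m)
  define w where "w = quad ^ n"
  define D where "D k = (pderiv ^^ k) w" for k
  have D_Suc: "pderiv (D k) = D (Suc k)" for k
    by (simp add: D_def)
  \<comment> \<open>The classical derivation: \<open>w\<close> solves this first-order equation, and
    differentiating it n + 1 times (\<open>Suc (Suc m)\<close> is n + 1) gives an equation for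
    \<open>D n\<close>, a multiple of \<open>legendre_poly n\<close>.\<close>
  have "quad * pderiv w = smult (2 * n) (X * w)"
  proof -
    have "quad * pderiv w = smult (of_nat n) (quad ^ n * pderiv quad)"
      unfolding w_def Suc pderiv_power_Suc by (simp add: algebra_simps)
    also have "\<dots> = smult (2 * n) (X * w)"
      by (simp add: w_def mult.commute)
    finally show ?thesis .
  qed
  then have "(pderiv ^^ Suc (Suc m)) (quad * pderiv w) = smult (2 * n) ((pderiv ^^ Suc (Suc m)) (X * w))"
    by (simp only: higher_pderiv_smult)
  then have "quad * D (n + 2) + smult (2 * (n + 1)) (X * D (n + 1)) + smult (n * (n + 1)) (D n) =
      smult (2 * n) (X * D (n + 1) + smult (n + 1) (D n))"
    unfolding higher_pderiv_quad_mult higher_pderiv_X_mult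
    by (simp add: D_def Suc funpow_swap1 algebra_simps)
  then have eq: "quad * D (n + 2) = smult (2 * n) (X * D (n + 1) + smult (n + 1) (D n)) -
      (smult (2 * (n + 1)) (X * D (n + 1)) + smult (n * (n + 1)) (D n))"
    by (simp only: eq_diff_eq add.assoc)
  have "pderiv (quad * D (n + 1)) = quad * D (n + 2) + smult 2 (X * D (n + 1))"
    by (simp add: pderiv_mult D_Suc add.commute mult.commute)
  also have "\<dots> = smult (real n * (real n + 1)) (D n)"
    unfolding eq by (rule poly_ext) (simp add: algebra_simps)
  finally have "pderiv (quad * D (n + 1)) = smult (real n * (real n + 1)) (D n)" .
  then show ?thesis
    by (simp add: legendre_poly_quad pderiv_smult D_def w_def mult.left_commute)
qed simp

section \<open>Expansion in Legendre polynomials\<close>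

lemma legendre_span:
  assumes "degree q \<le> N"
  shows "\<exists>c. q = (\<Sum>j\<le>N. smult (c j) (legendre_poly j))"
  using assms
proof (induction N arbitrary: q)
  case 0
  then obtain a where "q = [:a:]"
    by (meson degree_eq_zeroE le_zero_eq)
  then show ?case
    by (intro exI[of _ "\<lambda>_. a"]) simp
next
  case (Suc N)
  \<comment> \<open>This multiple cancels the coefficient of degree \<open>Suc N\<close>, the exact
    degree of \<open>legendre_poly (Suc N)\<close>.\<close>
  define r where "r = q - smult (coeff q (Suc N) / lead_coeff (legendre_poly (Suc N))) (legendre_poly (Suc N))"
  have "lead_coeff (legendre_poly (Suc N)) \<noteq> 0"
    using degree_legendre[of "Suc N"] by (metis degree_0 leading_coeff_0_iff nat.distinct(1))
  then have "coeff r (Suc N) = 0"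
    by (simp add: r_def degree_legendre)
  moreover have "degree r \<le> Suc N"
    unfolding r_def using Suc.prems
    by (intro degree_diff_le) (auto intro: order.trans[OF degree_smult_le] simp: degree_legendre)
  ultimately have "degree r \<le> N"
    by (metis degree_0 eq_zero_or_degree_less le_SucE less_Suc_eq_le zero_le)
  from Suc.IH[OF this] obtain c where c: "r = (\<Sum>j\<le>N. smult (c j) (legendre_poly j))"
    by blast
  have "q = (\<Sum>j\<le>Suc N. smult
      ((c(Suc N := coeff q (Suc N) / lead_coeff (legendre_poly (Suc N)))) j) (legendre_poly j))"
    using c by (simp add: r_def diff_eq_eq)
  then show ?case
    by blast
qed

text \<open>Parseval's identity: orthogonality leaves only the diagonal of the double sum.\<close>

lemma pint_legendre_sums:
  assumes "finite A"
  shows "pint ((\<Sum>j\<in>A. smult (c j) (legendre_poly j)) * (\<Sum>j\<in>A. smult (d j) (legendre_poly j))) =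
    (\<Sum>j\<in>A. c j * d j * (2 / (2 * real j + 1)))"
proof -
  have "pint ((\<Sum>j\<in>A. smult (c j) (legendre_poly j)) * (\<Sum>j\<in>A. smult (d j) (legendre_poly j))) =
      (\<Sum>i\<in>A. \<Sum>j\<in>A. d j * (c i * (if i = j then 2 / (2 * real j + 1) else 0)))"
    by (simp add: sum_product pint_sum pint_smult pint_legendre mult_ac)
  also have "\<dots> = (\<Sum>i\<in>A. c i * d i * (2 / (2 * real i + 1)))"
    using assms by (intro sum.cong refl) (simp add: if_distrib mult_ac cong: if_cong)
  finally show ?thesis .
qed

subsection \<open>Integration by parts\<close>

text \<open>F is Lipschitz but need not be differentiable everywhere. Instead of differentiating F
  G, compare it with the integral up to t: the increments of the difference \<open>H\<close> are of
  order (v - u)^2, so \<open>H\<close> has derivative zero and is constant.\<close>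

lemma has_integral_by_parts_lipschitz:
  fixes f F G G' :: "real \<Rightarrow> real"
  assumes "a \<le> b"
    and f: "f absolutely_integrable_on {a..b}"
    and f_le: "\<And>t. t \<in> {a..b} \<Longrightarrow> \<bar>f t\<bar> \<le> m"
    and F: "\<And>t. t \<in> {a..b} \<Longrightarrow> F t = C + integral {a..t} f"
    and G: "\<And>t. t \<in> {a..b} \<Longrightarrow> (G has_real_derivative G' t) (at t within {a..b})"
    and G': "continuous_on {a..b} G'"
  shows "((\<lambda>t. F t * G' t + f t * G t) has_integral F b * G b - F a * G a) {a..b}"
proof -
  have "bounded (G' ` {a..b})"
    using G' by (intro compact_imp_bounded compact_continuous_image) auto
  then obtain B where "\<forall>t\<in>{a..b}. \<bar>G' t\<bar> \<le> B"
    by (auto simp: bounded_iff)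
  then have B: "\<And>t. t \<in> {a..b} \<Longrightarrow> \<bar>G' t\<bar> \<le> B"
    by blast
  have "0 \<le> m" "0 \<le> B"
    using f_le[of a] B[of a] \<open>a \<le> b\<close> by force+
  have f_int: "f integrable_on {u..v}" if "a \<le> u" "v \<le> b" for u v
    using that by (intro integrable_subinterval_real[OF set_lebesgue_integral_eq_integral(1)[OF f]]) auto
  have F_diff: "(f has_integral F v - F u) {u..v}" and F_le: "\<bar>F v - F u\<bar> \<le> m * (v - u)"
    if "a \<le> u" "u \<le> v" "v \<le> b" for u v
  proof -
    have "integral {a..u} f + integral {u..v} f = integral {a..v} f"
      using that f_int by (intro Henstock_Kurzweil_Integration.integral_combine) auto
    then show *: "(f has_integral F v - F u) {u..v}"
      using that F f_int[of u v] by (simp add: has_integral_iff)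
    show "\<bar>F v - F u\<bar> \<le> m * (v - u)"
      using has_integral_bound_real[OF \<open>0 \<le> m\<close> finite.emptyI *] f_le that by auto
  qed
  have G_diff: "(G' has_integral G v - G u) {u..v}" and G_le: "\<bar>G v - G u\<bar> \<le> B * (v - u)"
    if "a \<le> u" "u \<le> v" "v \<le> b" for u v
  proof -
    show *: "(G' has_integral G v - G u) {u..v}"
      using that by (intro fundamental_theorem_of_calculus)
        (auto simp flip: has_real_derivative_iff_has_vector_derivative intro: DERIV_subset[OF G])
    show "\<bar>G v - G u\<bar> \<le> B * (v - u)"
      using has_integral_bound_real[OF \<open>0 \<le> B\<close> finite.emptyI *] B that by auto
  qed
  have F_cont: "continuous_on {a..b} F"
    using continuous_on_add[OF continuous_on_const indefinite_integral_continuous_1[OF f_int[OF order.refl order.refl]]]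
    by (rule continuous_on_eq) (simp add: F)
  have G_cont: "continuous_on {a..b} G"
    using G by (rule DERIV_continuous_on)
  define h where "h t = F t * G' t + f t * G t" for t
  have "(\<lambda>t. G t * f t) absolutely_integrable_on {a..b}"
    using G_cont f
    by (intro absolutely_integrable_bounded_measurable_product_real compact_imp_bounded
          compact_continuous_image continuous_imp_measurable_on_sets_lebesgue) auto
  moreover have "(\<lambda>t. F t * G' t) absolutely_integrable_on {a..b}"
    by (intro absolutely_integrable_continuous_real continuous_intros F_cont G')
  ultimately have h_int: "h integrable_on {a..b}"
    unfolding h_def by (intro integrable_add) (auto simp: set_lebesgue_integral_eq_integral mult.commute)
  define H where "H t = integral {a..t} h - F t * G t" for t
  have H_le: "\<bar>H v - H u\<bar> \<le> 2 * m * B * (v - u)\<^sup>2" if uv: "a \<le> u" "u \<le> v" "v \<le> b" for u v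
  proof -
    have "integral {a..u} h + integral {u..v} h = integral {a..v} h"
      using uv by (intro Henstock_Kurzweil_Integration.integral_combine integrable_subinterval_real[OF h_int]) auto
    moreover have "(h has_integral integral {u..v} h) {u..v}"
      using uv by (intro integrable_integral integrable_subinterval_real[OF h_int]) auto
    ultimately have "(h has_integral integral {a..v} h - integral {a..u} h) {u..v}"
      by (metis add_diff_cancel_left')
    \<comment> \<open>The comparison integrand freezes \<open>F\<close> at u and \<open>G\<close> at
      v; its integral is exactly F v G v - F u G u.\<close>
    moreover have "((\<lambda>t. F u * G' t + f t * G v) has_integral F u * (G v - G u) + (F v - F u) * G v) {u..v}"
      using uv by (intro has_integral_add has_integral_mult_right has_integral_mult_left F_diff G_diff)
    ultimately have *: "((\<lambda>t. h t - (F u * G' t + f t * G v)) has_integral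
        integral {a..v} h - integral {a..u} h - (F u * (G v - G u) + (F v - F u) * G v)) {u..v}"
      by (rule has_integral_diff)
    have "\<bar>h t - (F u * G' t + f t * G v)\<bar> \<le> 2 * m * B * (v - u)" if "t \<in> {u..v}" for t
    proof -
      have "h t - (F u * G' t + f t * G v) = (F t - F u) * G' t + f t * (G t - G v)"
        by (simp add: h_def algebra_simps)
      also have "\<bar>\<dots>\<bar> \<le> \<bar>F t - F u\<bar> * \<bar>G' t\<bar> + \<bar>f t\<bar> * \<bar>G t - G v\<bar>"
        by (simp add: abs_triangle_ineq order.trans flip: abs_mult)
      also have "\<dots> \<le> m * (v - u) * B + m * (B * (v - u))"
      proof (intro add_mono mult_mono)
        have "m * (t - u) \<le> m * (v - u)"
          using \<open>0 \<le> m\<close> that by (intro mult_left_mono) auto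
        then show "\<bar>F t - F u\<bar> \<le> m * (v - u)"
          using F_le[of u t] uv that by auto
        have "B * (v - t) \<le> B * (v - u)"
          using \<open>0 \<le> B\<close> that by (intro mult_left_mono) auto
        then show "\<bar>G t - G v\<bar> \<le> B * (v - u)"
          using G_le[of t v] uv that by auto
      qed (use uv that B f_le \<open>0 \<le> m\<close> in auto)
      finally show ?thesis
        by (simp add: algebra_simps)
    qed
    then have "\<bar>integral {a..v} h - integral {a..u} h - (F u * (G v - G u) + (F v - F u) * G v)\<bar>
        \<le> 2 * m * B * (v - u) * (v - u)"
      using has_integral_bound_real[OF _ finite.emptyI *, of "2 * m * B * (v - u)"] uv \<open>0 \<le> m\<close> \<open>0 \<le> B\<close>
      by auto
    then show ?thesis
      by (simp add: H_def algebra_simps power2_eq_square)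
  qed
  have "(H has_real_derivative 0) (at t within {a..b})" if t: "t \<in> {a..b}" for t
  proof -
    have "((\<lambda>y. (H y - H t) / (y - t)) \<longlongrightarrow> 0) (at t within {a..b})"
    proof (rule Lim_null_comparison)
      have "\<bar>(H y - H t) / (y - t)\<bar> \<le> 2 * m * B * \<bar>y - t\<bar>" if "y \<in> {a..b}" "y \<noteq> t" for y
      proof -
        have "\<bar>H y - H t\<bar> \<le> 2 * m * B * (\<bar>y - t\<bar> * \<bar>y - t\<bar>)"
          using H_le[of y t] H_le[of t y] t that
          by (cases "y \<le> t") (auto simp: abs_minus_commute power2_eq_square algebra_simps)
        then show ?thesis
          using that by (simp add: abs_divide divide_le_eq mult.assoc)
      qed
      then show "\<forall>\<^sub>F y in at t within {a..b}. norm ((H y - H t) / (y - t)) \<le> 2 * m * B * \<bar>y - t\<bar>"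
        by (auto simp: eventually_at_filter)
      show "((\<lambda>y. 2 * m * B * \<bar>y - t\<bar>) \<longlongrightarrow> 0) (at t within {a..b})"
        by (auto intro!: tendsto_eq_intros)
    qed
    then show ?thesis
      by (simp add: has_field_derivative_iff)
  qed
  then obtain c where "\<And>t. t \<in> {a..b} \<Longrightarrow> H t = c"
    using has_field_derivative_zero_constant[of "{a..b}" H] by auto
  then have "H b = H a"
    using \<open>a \<le> b\<close> by simp
  then have "integral {a..b} h = F b * G b - F a * G a"
    by (simp add: H_def)
  with h_int show ?thesis
    unfolding h_def by (simp add: has_integral_iff)
qed

subsection \<open>Essentially bounded functions\<close>

text \<open>The real L_infinity functions on [-x, x]. The class is closed under sums and products
  and consists of integrable functions, which settles the integrability conditions below.\<close>

definition ess_bdd :: "real \<Rightarrow> (real \<Rightarrow> real) \<Rightarrow> bool" where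
  "ess_bdd x f \<longleftrightarrow> f \<in> borel_measurable (lebesgue_on {-x..x}) \<and>
     (\<exists>m. AE t in lebesgue_on {-x..x}. \<bar>f t\<bar> \<le> m)"

lemma AE_lebesgue_on_iff_negligible:
  "(AE t in lebesgue_on {a..b::real}. P t) \<longleftrightarrow> negligible {t \<in> {a..b}. \<not> P t}"
  by (simp add: AE_restrict_space_iff completion.AE_iff_null_sets negligible_iff_null_sets)

lemma ess_bdd_integrable:
  assumes "ess_bdd x f"
  shows "integrable (lebesgue_on {-x..x}) f"
proof -
  obtain m where "AE t in lebesgue_on {-x..x}. norm (f t) \<le> m"
    using assms by (auto simp: ess_bdd_def)
  with assms show ?thesis
    by (intro finite_measure.integrable_const_bound[OF finite_measure_lebesgue_on])
       (auto simp: ess_bdd_def)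
qed

lemma ess_bdd_continuous:
  assumes "continuous_on {-x..x} f"
  shows "ess_bdd x f"
proof -
  have "bounded (f ` {-x..x})"
    using assms by (intro compact_imp_bounded compact_continuous_image) auto
  then obtain m where "\<forall>t\<in>{-x..x}. \<bar>f t\<bar> \<le> m"
    by (auto simp: bounded_iff)
  then have "AE t in lebesgue_on {-x..x}. \<bar>f t\<bar> \<le> m"
    by (intro AE_I2) auto
  then show ?thesis
    using assms by (auto simp: ess_bdd_def intro: continuous_imp_measurable_on_sets_lebesgue)
qed

lemma ess_bdd_poly: "ess_bdd x (\<lambda>t. poly q (t / y))"
  \<comment> \<open>For \<open>y = 0\<close> the quotient \<open>t / y\<close> is 0 and the function
    is constant.\<close>
  by (cases "y = 0") (auto intro!: ess_bdd_continuous continuous_intros)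

lemma ess_bdd_add:
  assumes "ess_bdd x f" "ess_bdd x g"
  shows "ess_bdd x (\<lambda>t. f t + g t)"
proof -
  obtain m n where "AE t in lebesgue_on {-x..x}. \<bar>f t\<bar> \<le> m" "AE t in lebesgue_on {-x..x}. \<bar>g t\<bar> \<le> n"
    using assms by (auto simp: ess_bdd_def)
  then have "AE t in lebesgue_on {-x..x}. \<bar>f t + g t\<bar> \<le> m + n"
    by eventually_elim auto
  then show ?thesis
    using assms by (auto simp: ess_bdd_def)
qed

lemma ess_bdd_mult:
  assumes "ess_bdd x f" "ess_bdd x g"
  shows "ess_bdd x (\<lambda>t. f t * g t)"
proof -
  obtain m n where "AE t in lebesgue_on {-x..x}. \<bar>f t\<bar> \<le> m" "AE t in lebesgue_on {-x..x}. \<bar>g t\<bar> \<le> n"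
    using assms by (auto simp: ess_bdd_def)
  then have "AE t in lebesgue_on {-x..x}. \<bar>f t * g t\<bar> \<le> m * n"
    by eventually_elim (auto simp: abs_mult intro!: mult_mono)
  then show ?thesis
    using assms by (auto simp: ess_bdd_def)
qed

lemma ess_bdd_diff:
  assumes "ess_bdd x f" "ess_bdd x g"
  shows "ess_bdd x (\<lambda>t. f t - g t)"
  using ess_bdd_add[OF assms(1) ess_bdd_mult[OF ess_bdd_continuous[OF continuous_on_const[of _ "-1"]] assms(2)]]
  by simp

text \<open>Lebesgue measure is complete, so \<open>g\<close> inherits measurability; this is
  obtained through integrability, which survives a change on a negligible set.\<close>

lemma ess_bdd_cong_AE:
  assumes "ess_bdd x f" "AE t in lebesgue_on {-x..x}. g t = f t"
  shows "ess_bdd x g"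
proof -
  have "f integrable_on {-x..x}"
    using ess_bdd_integrable[OF assms(1)] by (auto intro: integrable_on_lebesgue_on)
  moreover have "negligible {t \<in> {-x..x}. g t \<noteq> f t}"
    using assms(2) by (simp add: AE_lebesgue_on_iff_negligible)
  ultimately have "g integrable_on {-x..x}"
    by (rule integrable_spike) auto
  then have "g \<in> borel_measurable (lebesgue_on {-x..x})"
    by (rule integrable_imp_measurable)
  moreover obtain m where "AE t in lebesgue_on {-x..x}. \<bar>f t\<bar> \<le> m"
    using assms by (auto simp: ess_bdd_def)
  with assms(2) have "AE t in lebesgue_on {-x..x}. \<bar>g t\<bar> \<le> m"
    by eventually_elim auto
  ultimately show ?thesis
    by (auto simp: ess_bdd_def)
qed

lemma lebesgue_integral_poly_scaled:
  assumes "x > 0"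
  shows "(LINT t|lebesgue_on {-x..x}. poly q (t / x)) = x * pint q"
proof -
  have "(\<lambda>t. t / (1 / x)) ` {-1..1} = {-x..x}"
    using assms by (simp add: image_mult_atLeastAtMost mult.commute[of _ x])
  with has_integral_stretch_real[OF has_integral_pint[of q], of "1 / x"] assms
  have "((\<lambda>t. poly q (t / x)) has_integral x * pint q) {-x..x}"
    by simp
  then show ?thesis
    using ess_bdd_integrable[OF ess_bdd_poly]
    by (simp add: lebesgue_integral_eq_integral integral_unique)
qed

lemma ess_bdd_indefinite_integral:
  assumes "ess_bdd x f" and F: "\<And>t. t \<in> {-x..x} \<Longrightarrow> F t = C + integral {-x..t} f"
  shows "continuous_on {-x..x} F"
proof -
  have "f integrable_on {-x..x}"
    using ess_bdd_integrable[OF assms(1)] by (auto intro: integrable_on_lebesgue_on)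
  then have "continuous_on {-x..x} (\<lambda>t. C + integral {-x..t} f)"
    by (intro continuous_intros indefinite_integral_continuous_1)
  then show ?thesis
    by (rule continuous_on_eq) (simp add: F)
qed

text \<open>The zeros of \<open>P\<close> at 1 and -1 remove the boundary terms; the factor x comes
  from the chain rule for \<open>t / x\<close>.\<close>

lemma integral_by_parts_poly:
  assumes x: "x > 0" and f: "ess_bdd x f"
    and F: "\<And>t. t \<in> {-x..x} \<Longrightarrow> F t = C + integral {-x..t} f"
    and P: "poly P 1 = 0" "poly P (-1) = 0"
  shows "(LINT t|lebesgue_on {-x..x}. F t * poly (pderiv P) (t / x)) =
           - x * (LINT t|lebesgue_on {-x..x}. f t * poly P (t / x))"
proof -
  let ?M = "lebesgue_on {-x..x}"
  obtain m where m: "AE t in ?M. \<bar>f t\<bar> \<le> m"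
    using f by (auto simp: ess_bdd_def)
  define N where "N = {t \<in> {-x..x}. \<not> \<bar>f t\<bar> \<le> m}"
  have N: "negligible N"
    using m by (simp add: AE_lebesgue_on_iff_negligible N_def)
  \<comment> \<open>Integration by parts was shown for a bound at every point. The truncation
    provides one and changes \<open>f\<close> only on \<open>N\<close>; \<open>max m 0\<close> keeps
    the bound nonnegative.\<close>
  define g where "g t = (if \<bar>f t\<bar> \<le> max m 0 then f t else 0)" for t
  have g_eq: "g t = f t" if "t \<in> {-x..x} - N" for t
    using that by (auto simp: g_def N_def)
  have g_le: "\<bar>g t\<bar> \<le> max m 0" for t
    by (simp add: g_def)
  have g_AE: "AE t in ?M. g t = f t"
    using m by eventually_elim (simp add: g_def)
  have "ess_bdd x g"
    using f g_AE by (rule ess_bdd_cong_AE)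
  then have "g \<in> borel_measurable ?M"
    by (simp add: ess_bdd_def)
  then have "g absolutely_integrable_on {-x..x}"
    by (rule measurable_bounded_by_integrable_imp_absolutely_integrable[where g = "\<lambda>_. max m 0"])
       (auto simp: g_le)
  moreover have "F t = C + integral {-x..t} g" if "t \<in> {-x..x}" for t
  proof -
    have "integral {-x..t} f = integral {-x..t} g"
      using that by (intro integral_spike[OF N]) (auto simp: g_eq)
    then show ?thesis
      using F that by simp
  qed
  ultimately have "((\<lambda>t. F t * (poly (pderiv P) (t / x) / x) + g t * poly P (t / x)) has_integral
      F x * poly P (x / x) - F (-x) * poly P (-x / x)) {-x..x}"
    using x
    by (intro has_integral_by_parts_lipschitz[where m = "max m 0" and C = C])
       (auto simp: g_le intro!: derivative_eq_intros DERIV_chain2[OF poly_DERIV] continuous_intros)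
  then have *: "((\<lambda>t. F t * (poly (pderiv P) (t / x) / x) + g t * poly P (t / x)) has_integral 0) {-x..x}"
    using x P by simp
  have "ess_bdd x F"
    using ess_bdd_indefinite_integral[OF f F] by (rule ess_bdd_continuous)
  then have int: "integrable ?M (\<lambda>t. F t * poly (pderiv P) (t / x))"
    "integrable ?M (\<lambda>t. g t * poly P (t / x))"
    "integrable ?M (\<lambda>t. f t * poly P (t / x))"
    using f \<open>ess_bdd x g\<close> by (auto intro!: ess_bdd_integrable ess_bdd_mult ess_bdd_poly)
  have "0 = (LINT t|?M. F t * (poly (pderiv P) (t / x)) / x + g t * poly P (t / x))"
    using int * by (subst lebesgue_integral_eq_integral) (auto simp: integral_unique)
  also have "\<dots> = (LINT t|?M. F t * (poly (pderiv P) (t / x))) / x + (LINT t|?M. g t * poly P (t / x))"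
    using int by simp
  also have "(LINT t|?M. g t * poly P (t / x)) = (LINT t|?M. f t * poly P (t / x))"
    using g_AE int by (intro integral_cong_AE) auto
  finally show ?thesis
    using x by (simp add: field_simps)
qed

subsection \<open>Legendre partial sums\<close>

definition ip :: "real \<Rightarrow> (real \<Rightarrow> real) \<Rightarrow> real poly \<Rightarrow> real" where
  "ip x f q = (LINT t|lebesgue_on {-x..x}. f t * poly q (t / x))"

definition sqerr :: "real \<Rightarrow> (real \<Rightarrow> real) \<Rightarrow> real poly \<Rightarrow> real" where
  "sqerr x f q = (LINT t|lebesgue_on {-x..x}. (f t - poly q (t / x))\<^sup>2)"

text \<open>The real counterpart of \<open>legendre_coeff F j x / of_real x\<close>: the factor 1 /
  x of the partial sum is included.\<close>

definition lcoef :: "real \<Rightarrow> (real \<Rightarrow> real) \<Rightarrow> nat \<Rightarrow> real" where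
  "lcoef x f j = (2 * real j + 1) / (2 * x) * ip x f (legendre_poly j)"

text \<open>The mean-square projection of \<open>f\<close> to degree at most N, kept as a polynomial
  in the variable t / x.\<close>

definition lproj :: "real \<Rightarrow> nat \<Rightarrow> (real \<Rightarrow> real) \<Rightarrow> real poly" where
  "lproj x N f = (\<Sum>j\<le>N. smult (lcoef x f j) (legendre_poly j))"

lemma ip_integrable:
  "ess_bdd x f \<Longrightarrow> integrable (lebesgue_on {-x..x}) (\<lambda>t. f t * poly q (t / x))"
  by (intro ess_bdd_integrable ess_bdd_mult ess_bdd_poly)

lemma ip_add: "ess_bdd x f \<Longrightarrow> ip x f (p + q) = ip x f p + ip x f q"
  by (simp add: ip_def distrib_left ip_integrable)

lemma ip_smult: "ip x f (smult c q) = c * ip x f q"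
  by (simp add: ip_def mult.left_commute)

lemma ip_sum: "ess_bdd x f \<Longrightarrow> ip x f (sum q A) = (\<Sum>i\<in>A. ip x f (q i))"
proof (induction A rule: infinite_finite_induct)
  case (insert i A)
  then show ?case
    by (simp add: ip_add)
qed (simp_all add: ip_def)

lemma sqerr_expand:
  assumes "x > 0" "ess_bdd x f"
  shows "sqerr x f q = (LINT t|lebesgue_on {-x..x}. (f t)\<^sup>2) - 2 * ip x f q + x * pint (q * q)"
proof -
  have int: "integrable (lebesgue_on {-x..x}) (\<lambda>t. f t * f t)"
    "integrable (lebesgue_on {-x..x}) (\<lambda>t. poly q (t / x) * poly q (t / x))"
    using assms by (auto intro!: ess_bdd_integrable ess_bdd_mult ess_bdd_poly)
  have "sqerr x f q = (LINT t|lebesgue_on {-x..x}.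
      f t * f t - 2 * (f t * poly q (t / x)) + poly q (t / x) * poly q (t / x))"
    by (simp add: sqerr_def power2_eq_square algebra_simps)
  also have "\<dots> = (LINT t|lebesgue_on {-x..x}. f t * f t) - 2 * ip x f q +
      (LINT t|lebesgue_on {-x..x}. poly q (t / x) * poly q (t / x))"
    using int ip_integrable[OF assms(2)] by (simp add: ip_def)
  also have "(LINT t|lebesgue_on {-x..x}. poly q (t / x) * poly q (t / x)) = x * pint (q * q)"
    using lebesgue_integral_poly_scaled[OF assms(1), of "q * q"] by simp
  finally show ?thesis
    by (simp add: power2_eq_square)
qed

lemma degree_lproj: "degree (lproj x N f) \<le> N"
  unfolding lproj_def
  by (intro degree_sum_le) (auto intro: order.trans[OF degree_smult_le] simp: degree_legendre)

lemma ip_legendre: "x > 0 \<Longrightarrow> ip x f (legendre_poly j) = x * (lcoef x f j * (2 / (2 * real j + 1)))"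
  by (simp add: lcoef_def divide_simps)

text \<open>The projection error is orthogonal to all polynomials of degree at most N, because it is
  so on the Legendre basis.\<close>

lemma ip_lproj:
  assumes "x > 0" "ess_bdd x f" "degree q \<le> N"
  shows "ip x f q = x * pint (lproj x N f * q)"
proof -
  obtain c where "q = (\<Sum>j\<le>N. smult (c j) (legendre_poly j))"
    using legendre_span[OF assms(3)] by blast
  then show ?thesis
    using assms(1,2) unfolding lproj_def
    by (simp only: pint_legendre_sums finite_atMost ip_sum ip_smult ip_legendre)
       (simp add: sum_distrib_left mult_ac)
qed

lemma sqerr_pythagoras:
  assumes "x > 0" "ess_bdd x f" "degree r \<le> N"
  shows "sqerr x f (lproj x N f + r) = sqerr x f (lproj x N f) + x * pint (r * r)"
proof -
  have "pint ((lproj x N f + r) * (lproj x N f + r)) =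
      pint (lproj x N f * lproj x N f) + 2 * pint (lproj x N f * r) + pint (r * r)"
    by (simp only: distrib_left distrib_right pint_add mult.commute[of r "lproj x N f"])
  then show ?thesis
    using assms by (simp add: sqerr_expand ip_add ip_lproj[of x f r N] algebra_simps)
qed

lemma pint_square_nonneg: "pint (r * r) \<ge> 0"
  unfolding pint_def by (intro integral_nonneg poly_integrable) auto

text \<open>A competitor differs from the projection by a polynomial of degree at most N, so
  Pythagoras applies.\<close>

lemma sqerr_lproj_le:
  assumes "x > 0" "ess_bdd x f" "degree q \<le> N"
  shows "sqerr x f (lproj x N f) \<le> sqerr x f q"
proof -
  have "degree (q - lproj x N f) \<le> N"
    using assms(3) degree_lproj by (rule degree_diff_le)
  from sqerr_pythagoras[OF assms(1,2) this] show ?thesis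
    using pint_square_nonneg[of "q - lproj x N f"] assms(1) by simp
qed

subsection \<open>A Jackson inequality in the mean\<close>

lemma poly_approx_scaled:
  fixes F :: "real \<Rightarrow> real"
  assumes "continuous_on {-x..x} F" "x > 0" "e > 0"
  shows "\<exists>q. \<forall>t\<in>{-x..x}. \<bar>F t - poly q (t / x)\<bar> < e"
proof -
  obtain g where "real_polynomial_function g" and g: "\<And>t. t \<in> {-x..x} \<Longrightarrow> \<bar>F t - g t\<bar> < e"
    using Stone_Weierstrass_real_polynomial_function[of "{-x..x}" F e] assms by auto
  then obtain a n where a: "g = (\<lambda>t. \<Sum>i\<le>n. a i * t ^ i)"
    using real_polynomial_function_iff_sum by blast
  \<comment> \<open>The powers of x in the coefficients undo the scaling of the variable.\<close>
  define q where "q = (\<Sum>i\<le>n. monom (a i * x ^ i) i)"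
  have "poly q (t / x) = g t" for t
    unfolding q_def a poly_sum using \<open>x > 0\<close>
    by (intro sum.cong refl) (simp add: poly_monom power_divide)
  with g show ?thesis
    by metis
qed

lemma sqerr_le_bound:
  assumes "x > 0" "ess_bdd x f" "AE t in lebesgue_on {-x..x}. \<bar>f t - poly q (t / x)\<bar> \<le> e"
  shows "sqerr x f q \<le> 2 * x * e\<^sup>2"
proof -
  have "sqerr x f q \<le> (LINT t|lebesgue_on {-x..x}. e\<^sup>2)"
    unfolding sqerr_def
  proof (intro integral_mono_AE)
    show "integrable (lebesgue_on {-x..x}) (\<lambda>t. (f t - poly q (t / x))\<^sup>2)"
      unfolding power2_eq_square
      by (intro ess_bdd_integrable ess_bdd_mult ess_bdd_diff ess_bdd_poly assms)
    show "AE t in lebesgue_on {-x..x}. (f t - poly q (t / x))\<^sup>2 \<le> e\<^sup>2"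
      using assms(3) by eventually_elim (simp add: abs_le_square_iff[symmetric])
  qed simp
  also have "\<dots> = 2 * x * e\<^sup>2"
    using lebesgue_integral_poly_scaled[OF assms(1), of "[:e\<^sup>2:]"] pint_pderiv[of "smult (e\<^sup>2) X"]
    by (simp add: pderiv_smult smult_one pint_smult mult.commute)
  finally show ?thesis .
qed

text \<open>By Legendre's equation, \<open>quad * pderiv (legendre_poly j)\<close> is an antiderivative of
  \<open>j (j + 1) legendre_poly j\<close> that vanishes at the end points. Integrating by parts, the tail \<open>T\<close>
  of the Legendre series of \<open>F\<close> is therefore obtained from the orthogonal projection of \<open>f = F'\<close>
  to the span of the derivatives of the Legendre polynomials, which are orthogonal with respect
  to the weight \<open>x\<^sup>2 - t\<^sup>2\<close>.\<close>

lemma legendre_tail_le: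
  assumes x: "x > 0" and f: "ess_bdd x f"
    and F: "\<And>t. t \<in> {-x..x} \<Longrightarrow> F t = C + integral {-x..t} f"
    and "finite A" and A: "\<And>j. j \<in> A \<Longrightarrow> N < j"
  defines "T \<equiv> \<Sum>j\<in>A. smult (lcoef x F j) (legendre_poly j)"
  shows "x * pint (T * T) \<le> (x / (real N + 1))\<^sup>2 * (LINT t|lebesgue_on {-x..x}. (f t)\<^sup>2)"
proof -
  let ?M = "lebesgue_on {-x..x}"
  \<comment> \<open>The least eigenvalue j (j + 1) with j > N.\<close>
  define l where "l = (real N + 1) * (real N + 2)"
  \<comment> \<open>Dividing each coefficient by its eigenvalue makes
    \<open>pderiv (quad * pderiv U)\<close> equal to \<open>T\<close>.\<close>
  define U where "U = (\<Sum>j\<in>A. smult (lcoef x F j / (real j * (real j + 1))) (legendre_poly j))"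
  have "l > 0"
    by (simp add: l_def)
  have F_bdd: "ess_bdd x F"
    using ess_bdd_indefinite_integral[OF f F] by (rule ess_bdd_continuous)
  have "pderiv (quad * pderiv U) = (\<Sum>j\<in>A. smult (lcoef x F j / (real j * (real j + 1)))
      (pderiv (quad * pderiv (legendre_poly j))))"
    unfolding U_def higher_pderiv_sum[of 1, simplified] sum_distrib_left
    by (simp only: pderiv_smult mult_smult_right)
  also have "\<dots> = T"
    unfolding T_def legendre_ode using A by (intro sum.cong refl) fastforce
  finally have U: "pderiv (quad * pderiv U) = T" .

  have ip_T: "ip x F T = x * pint (T * T)"
    using x \<open>finite A\<close> unfolding T_def
    by (simp only: pint_legendre_sums ip_sum[OF F_bdd] ip_smult ip_legendre)
       (simp add: sum_distrib_left mult_ac)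
  have "ip x F T = - x * ip x f (quad * pderiv U)"
    using integral_by_parts_poly[OF x f F, of "quad * pderiv U"] by (simp add: ip_def U)
  with ip_T have "x * ip x f (quad * pderiv U) = x * - pint (T * T)"
    by simp
  then have ip_f: "ip x f (quad * pderiv U) = - pint (T * T)"
    using x by (simp only: mult_cancel_left) simp

  \<comment> \<open>The weighted square norm of \<open>pderiv U\<close> is the pairing of
    \<open>U\<close> with \<open>T\<close>, and the division by eigenvalues gains at least 1 / l
    there.\<close>
  have "pint (quad * pderiv U * pderiv U) = - pint (U * T)"
    using pint_by_parts[of "quad * pderiv U" U] by (simp add: U mult.commute)
  moreover have "pint (U * T) \<le> pint (T * T) / l"
  proof -
    have "pint (U * T) = (\<Sum>j\<in>A. lcoef x F j / (real j * (real j + 1)) * lcoef x F j * (2 / (2 * real j + 1)))"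
      unfolding U_def T_def by (rule pint_legendre_sums) fact
    also have "\<dots> \<le> (\<Sum>j\<in>A. lcoef x F j * lcoef x F j * (2 / (2 * real j + 1)) / l)"
    proof (rule sum_mono)
      fix j assume "j \<in> A"
      then have "real N + 1 \<le> real j" "0 < j"
        using A by fastforce+
      then have "l \<le> real j * (real j + 1)"
        unfolding l_def by (intro mult_mono) auto
      then have "lcoef x F j * lcoef x F j * (2 / (2 * real j + 1)) / (real j * (real j + 1)) \<le>
          lcoef x F j * lcoef x F j * (2 / (2 * real j + 1)) / l"
        using \<open>l > 0\<close> \<open>0 < j\<close> by (intro divide_left_mono mult_pos_pos) auto
      then show "lcoef x F j / (real j * (real j + 1)) * lcoef x F j * (2 / (2 * real j + 1)) \<le>
          lcoef x F j * lcoef x F j * (2 / (2 * real j + 1)) / l"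
        by (simp add: mult_ac)
    qed
    also have "\<dots> = pint (T * T) / l"
      unfolding T_def using \<open>finite A\<close> by (simp add: pint_legendre_sums sum_divide_distrib)
    finally show ?thesis .
  qed
  ultimately have weighted: "- pint (quad * pderiv U * pderiv U) \<le> pint (T * T) / l"
    by simp

  let ?I = "LINT t|?M. (f t)\<^sup>2"
  let ?w = "\<lambda>t. - poly quad (t / x)"
  let ?V = "\<lambda>t. l * poly (pderiv U) (t / x)"
  have int: "integrable ?M (\<lambda>t. (f t)\<^sup>2)" "integrable ?M (\<lambda>t. (f t)\<^sup>2 * ?w t)"
      "integrable ?M (\<lambda>t. f t * poly (quad * pderiv U) (t / x))"
      "integrable ?M (\<lambda>t. poly (quad * pderiv U * pderiv U) (t / x))"
    unfolding power2_eq_square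
    using f ess_bdd_mult[OF f f] ess_bdd_mult[OF ess_bdd_mult[OF f f] ess_bdd_poly[of x "- quad" x]]
    by (auto intro!: ess_bdd_integrable ess_bdd_mult ess_bdd_poly simp del: poly_mult)
  \<comment> \<open>A completed square in place of Cauchy-Schwarz. With the multiplier
    \<open>l\<close>, the mixed and the quadratic term together are at most
    \<open>- l * (x * pint (T * T))\<close>.\<close>
  have "0 \<le> (LINT t|?M. ?w t * (x * f t - ?V t)\<^sup>2)"
    using x by (intro Bochner_Integration.integral_nonneg mult_nonneg_nonneg)
      (auto simp: power_divide intro!: power2_le_iff_abs_le[THEN iffD2])
  also have "\<dots> = (LINT t|?M. x\<^sup>2 * ((f t)\<^sup>2 * ?w t) + 2 * l * x * (f t * poly (quad * pderiv U) (t / x))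
      - l\<^sup>2 * poly (quad * pderiv U * pderiv U) (t / x))"
    by (intro Bochner_Integration.integral_cong refl) (simp add: power2_eq_square algebra_simps)
  also have "\<dots> = x\<^sup>2 * (LINT t|?M. (f t)\<^sup>2 * ?w t) + 2 * l * x * ip x f (quad * pderiv U)
      - l\<^sup>2 * (x * pint (quad * pderiv U * pderiv U))"
    using int by (simp add: ip_def lebesgue_integral_poly_scaled[OF x] del: poly_mult poly_quad)
  also have "\<dots> \<le> x\<^sup>2 * ?I - 2 * l * x * pint (T * T) + l\<^sup>2 * (x * (pint (T * T) / l))"
  proof -
    have "(LINT t|?M. (f t)\<^sup>2 * ?w t) \<le> ?I"
      using int by (intro integral_mono) (auto intro!: mult_left_le)
    then have "x\<^sup>2 * (LINT t|?M. (f t)\<^sup>2 * ?w t) \<le> x\<^sup>2 * ?I"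
      by (intro mult_left_mono) auto
    moreover have "l\<^sup>2 * (x * - pint (quad * pderiv U * pderiv U)) \<le> l\<^sup>2 * (x * (pint (T * T) / l))"
      using weighted x by (intro mult_left_mono) auto
    ultimately show ?thesis
      unfolding ip_f by simp
  qed
  also have "\<dots> = x\<^sup>2 * ?I - l * (x * pint (T * T))"
    using \<open>l > 0\<close> by (simp add: power2_eq_square)
  finally have "l * (x * pint (T * T)) \<le> x\<^sup>2 * ?I"
    by simp
  \<comment> \<open>Weakening \<open>l\<close> to (N + 1)^2 gives the factor x / (N + 1).\<close>
  moreover have "(real N + 1)\<^sup>2 * (x * pint (T * T)) \<le> l * (x * pint (T * T))"
    using x pint_square_nonneg[of T]
    by (intro mult_right_mono mult_nonneg_nonneg) (auto simp: l_def power2_eq_square intro!: mult_left_mono)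
  ultimately show ?thesis
    by (simp add: power_divide field_simps)
qed

text \<open>The tail bound does not depend on the length of the tail, so the tail may be cut where
  the Weierstrass theorem makes the remaining error at most \<open>e\<close>.\<close>

lemma sqerr_lproj_integral_le:
  assumes x: "x > 0" and f: "ess_bdd x f"
    and F: "\<And>t. t \<in> {-x..x} \<Longrightarrow> F t = C + integral {-x..t} f"
  shows "sqerr x F (lproj x N F) \<le> (x / (real N + 1))\<^sup>2 * (LINT t|lebesgue_on {-x..x}. (f t)\<^sup>2)"
proof (rule field_le_epsilon)
  fix e :: real assume "e > 0"
  have cont: "continuous_on {-x..x} F"
    using f F by (rule ess_bdd_indefinite_integral)
  then have F_bdd: "ess_bdd x F"
    by (rule ess_bdd_continuous)
  \<comment> \<open>A uniform error \<open>d\<close> on an interval of length 2 x has square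
    integral at most \<open>e\<close>.\<close>
  define d where "d = sqrt (e / (2 * x))"
  have "d > 0" "2 * x * d\<^sup>2 = e"
    using x \<open>e > 0\<close> by (simp_all add: d_def)
  obtain q where q: "\<forall>t\<in>{-x..x}. \<bar>F t - poly q (t / x)\<bar> < d"
    using poly_approx_scaled[OF cont x \<open>d > 0\<close>] by blast
  \<comment> \<open>Large enough for \<open>q\<close> to compete with \<open>lproj x L F\<close>,
    and at least N so that the two projections differ by a tail.\<close>
  define L where "L = max N (degree q)"
  define T where "T = (\<Sum>j\<in>{N<..L}. smult (lcoef x F j) (legendre_poly j))"
  have "{..L} = {..N} \<union> {N<..L}"
    by (auto simp: L_def)
  then have "lproj x L F = lproj x N F + T"
    unfolding lproj_def T_def by (simp only:) (intro sum.union_disjoint, auto)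
  then have L: "lproj x N F = lproj x L F + (- T)"
    by simp
  have "degree T \<le> L"
    unfolding T_def by (intro degree_sum_le) (auto intro: order.trans[OF degree_smult_le] simp: degree_legendre)
  then have "sqerr x F (lproj x N F) = sqerr x F (lproj x L F) + x * pint (T * T)"
    unfolding L using sqerr_pythagoras[OF x F_bdd, of "- T" L] by simp
  moreover have "sqerr x F (lproj x L F) \<le> sqerr x F q"
    by (rule sqerr_lproj_le[OF x F_bdd]) (simp add: L_def)
  moreover have "AE t in lebesgue_on {-x..x}. \<bar>F t - poly q (t / x)\<bar> \<le> d"
    using q by (intro AE_I2) (auto simp: less_imp_le)
  with \<open>2 * x * d\<^sup>2 = e\<close> have "sqerr x F q \<le> e"
    using sqerr_le_bound[OF x F_bdd, of q d] by simp
  moreover have "x * pint (T * T) \<le> (x / (real N + 1))\<^sup>2 * (LINT t|lebesgue_on {-x..x}. (f t)\<^sup>2)"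
    unfolding T_def by (rule legendre_tail_le[OF x f F]) auto
  ultimately show "sqerr x F (lproj x N F) \<le>
      (x / (real N + 1))\<^sup>2 * (LINT t|lebesgue_on {-x..x}. (f t)\<^sup>2) + e"
    by simp
qed

subsection \<open>Weak derivatives\<close>

text \<open>\<open>\<phi>\<close> will be \<open>Re\<close> or \<open>Im\<close>. The induction
  carries \<open>ess_bdd\<close> along, since the next case needs it for the derivative. The
  constant \<open>2 ^ (k * k)\<close> leaves room for a factor \<open>2 ^ k\<close> lost in each
  step.\<close>

lemma weak_deriv_poly_approx:
  fixes \<phi> :: "complex \<Rightarrow> real"
  assumes \<phi>: "bounded_linear \<phi>" "\<And>z. \<bar>\<phi> z\<bar> \<le> norm z" and x: "x > 0"
    and "nth_weak_deriv k (-x) x f g" and g: "AE t in lebesgue_on {-x..x}. norm (g t) \<le> m"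
  shows "ess_bdd x (\<lambda>t. \<phi> (f t)) \<and>
    (\<forall>N\<ge>k. \<exists>q. degree q \<le> N \<and>
      sqerr x (\<lambda>t. \<phi> (f t)) q \<le> (2 ^ (k * k) * (x / (real N + 1)) ^ k)\<^sup>2 * (2 * x * m\<^sup>2))"
  using assms(4)
proof (induction k arbitrary: f)
  case 0
  then have "g \<in> borel_measurable (lebesgue_on {-x..x})"
    by (auto intro: absolutely_integrable_imp_borel_measurable)
  then have "(\<lambda>t. \<phi> (g t)) \<in> borel_measurable (lebesgue_on {-x..x})"
    by (rule measurable_compose)
       (intro borel_measurable_continuous_onI linear_continuous_on \<phi>(1))
  moreover have "AE t in lebesgue_on {-x..x}. \<bar>\<phi> (g t)\<bar> \<le> m"
    using g by eventually_elim (use \<phi>(2) order.trans in blast)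
  ultimately have "ess_bdd x (\<lambda>t. \<phi> (g t))"
    by (auto simp: ess_bdd_def)
  moreover have f: "AE t in lebesgue_on {-x..x}. f t = g t"
    using 0 by simp
  then have "AE t in lebesgue_on {-x..x}. \<phi> (f t) = \<phi> (g t)"
    by eventually_elim simp
  ultimately have f_bdd: "ess_bdd x (\<lambda>t. \<phi> (f t))"
    by (rule ess_bdd_cong_AE)
  have "AE t in lebesgue_on {-x..x}. \<bar>\<phi> (f t) - poly 0 (t / x)\<bar> \<le> m"
    using f \<open>AE t in lebesgue_on {-x..x}. \<bar>\<phi> (g t)\<bar> \<le> m\<close> by eventually_elim simp
  from sqerr_le_bound[OF x f_bdd this] f_bdd show ?case
    by (auto intro!: exI[of _ 0])
next
  case (Suc k)
  let ?M = "lebesgue_on {-x..x}"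
  obtain f' C where f': "f' absolutely_integrable_on {-x..x}"
    and f: "AE t in ?M. f t = C + integral {-x..t} f'"
    and "nth_weak_deriv k (-x) x f' g"
    using Suc.prems by auto
  from Suc.IH[OF this(3)] have f'_bdd: "ess_bdd x (\<lambda>t. \<phi> (f' t))"
    and f'_approx: "\<And>N. N \<ge> k \<Longrightarrow> \<exists>q. degree q \<le> N \<and> sqerr x (\<lambda>t. \<phi> (f' t)) q \<le>
      (2 ^ (k * k) * (x / (real N + 1)) ^ k)\<^sup>2 * (2 * x * m\<^sup>2)"
    by auto
  \<comment> \<open>The continuous representative of \<open>\<phi> (f t)\<close>; the two agree
    almost everywhere.\<close>
  define F where "F t = \<phi> C + integral {-x..t} (\<lambda>t. \<phi> (f' t))" for t
  have "continuous_on {-x..x} F"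
    using f'_bdd by (rule ess_bdd_indefinite_integral) (simp add: F_def)
  then have F_bdd: "ess_bdd x F"
    by (rule ess_bdd_continuous)
  have "F t = \<phi> (C + integral {-x..t} f')" if "t \<in> {-x..x}" for t
  proof -
    have "f' integrable_on {-x..t}"
      using that by (intro integrable_subinterval_real[OF set_lebesgue_integral_eq_integral(1)[OF f']]) auto
    then show ?thesis
      using integral_linear[OF _ \<phi>(1)] linear_add[OF bounded_linear.linear[OF \<phi>(1)]]
      by (simp add: F_def o_def)
  qed
  then have "AE t in ?M. F t = \<phi> (C + integral {-x..t} f')"
    by (intro AE_I2) auto
  with f have f_F: "AE t in ?M. \<phi> (f t) = F t"
    by eventually_elim simp
  have f_bdd: "ess_bdd x (\<lambda>t. \<phi> (f t))"
    using F_bdd f_F by (rule ess_bdd_cong_AE)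
  have "\<exists>q. degree q \<le> N \<and> sqerr x (\<lambda>t. \<phi> (f t)) q \<le>
      (2 ^ (Suc k * Suc k) * (x / (real N + 1)) ^ Suc k)\<^sup>2 * (2 * x * m\<^sup>2)" if N: "N \<ge> Suc k" for N
  proof -
    \<comment> \<open>One degree is reserved for the antiderivative, so the bound for
      \<open>r\<close> has N where the claim has N + 1.\<close>
    obtain N' where N': "N = Suc N'" "N' \<ge> k"
      using N by (cases N) auto
    obtain r where r: "degree r \<le> N'"
      "sqerr x (\<lambda>t. \<phi> (f' t)) r \<le> (2 ^ (k * k) * (x / real N) ^ k)\<^sup>2 * (2 * x * m\<^sup>2)"
      using f'_approx[OF N'(2)] by (auto simp: N'(1) add.commute)
    obtain s where s: "pderiv s = r" "degree s \<le> Suc (degree r)"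
      using ex_antiderivative by blast
    \<comment> \<open>The factor x makes \<open>poly r (t / x)\<close> the derivative of the
      subtracted term.\<close>
    define F1 where "F1 t = F t - x * poly s (t / x)" for t
    define f1 where "f1 t = \<phi> (f' t) - poly r (t / x)" for t
    have f1_bdd: "ess_bdd x f1"
      unfolding f1_def by (intro ess_bdd_diff f'_bdd ess_bdd_poly)
    have F1: "F1 t = (\<phi> C - x * poly s (-1)) + integral {-x..t} f1" if t: "t \<in> {-x..x}" for t
    proof -
      have "((\<lambda>t. poly r (t / x)) has_integral x * poly s (t / x) - x * poly s (-x / x)) {-x..t}"
        using t x by (intro fundamental_theorem_of_calculus)
          (auto simp flip: has_real_derivative_iff_has_vector_derivative s(1)
                intro!: derivative_eq_intros DERIV_chain2[OF poly_DERIV])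
      moreover have "(\<lambda>t. \<phi> (f' t)) integrable_on {-x..t}"
        using t ess_bdd_integrable[OF f'_bdd]
        by (intro integrable_subinterval_real[OF integrable_on_lebesgue_on]) auto
      ultimately have "integral {-x..t} f1 =
          integral {-x..t} (\<lambda>t. \<phi> (f' t)) - (x * poly s (t / x) - x * poly s (-x / x))"
        unfolding f1_def by (intro integral_unique has_integral_diff integrable_integral)
      then show ?thesis
        using x by (simp add: F1_def F_def)
    qed
    \<comment> \<open>The error of \<open>q\<close> for \<open>F\<close> is that of the projection
      for \<open>F1\<close>, whose derivative \<open>f1\<close> is already small.\<close>
    define q where "q = smult x s + lproj x N F1"
    have "degree q \<le> N"
      unfolding q_def using s(2) r(1) N'(1) degree_lproj
      by (intro degree_add_le) (auto intro: order.trans[OF degree_smult_le])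
    have "sqerr x (\<lambda>t. \<phi> (f t)) q = sqerr x F q"
      unfolding sqerr_def
    proof (intro integral_cong_AE)
      show "AE t in ?M. (\<phi> (f t) - poly q (t / x))\<^sup>2 = (F t - poly q (t / x))\<^sup>2"
        using f_F by eventually_elim simp
    qed (use ess_bdd_diff[OF f_bdd ess_bdd_poly] ess_bdd_diff[OF F_bdd ess_bdd_poly]
         in \<open>auto simp: ess_bdd_def intro!: borel_measurable_power\<close>)
    also have "\<dots> = sqerr x F1 (lproj x N F1)"
      by (simp add: sqerr_def F1_def q_def algebra_simps)
    also have "\<dots> \<le> (x / (real N + 1))\<^sup>2 * sqerr x (\<lambda>t. \<phi> (f' t)) r"
      using sqerr_lproj_integral_le[OF x f1_bdd F1] by (simp add: sqerr_def f1_def)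
    also have "\<dots> \<le> (x / (real N + 1))\<^sup>2 * ((2 ^ (k * k) * (x / real N) ^ k)\<^sup>2 * (2 * x * m\<^sup>2))"
      using r(2) by (intro mult_left_mono) auto
    also have "\<dots> = (x / (real N + 1) * (2 ^ (k * k) * (x / real N) ^ k))\<^sup>2 * (2 * x * m\<^sup>2)"
      by (simp only: power_mult_distrib mult.assoc)
    also have "\<dots> \<le> (2 ^ (Suc k * Suc k) * (x / (real N + 1)) ^ Suc k)\<^sup>2 * (2 * x * m\<^sup>2)"
    proof (intro mult_right_mono power_mono)
      \<comment> \<open>Here N \<ge> 1 is used. The k-th power costs \<open>2 ^ k\<close>, which is
        absorbed by k^2 + k \<le> (k + 1)^2.\<close>
      have "x / real N \<le> 2 * (x / (real N + 1))"
        using x N'(1) by (simp add: field_simps)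
      then have "(x / real N) ^ k \<le> 2 ^ k * (x / (real N + 1)) ^ k"
        using x by (subst power_mult_distrib[symmetric]) (intro power_mono, auto)
      then have "x / (real N + 1) * (2 ^ (k * k) * (x / real N) ^ k) \<le>
          x / (real N + 1) * (2 ^ (k * k) * (2 ^ k * (x / (real N + 1)) ^ k))"
        using x by (intro mult_left_mono) auto
      also have "\<dots> = 2 ^ (k * k + k) * (x / (real N + 1)) ^ Suc k"
        by (simp add: power_add)
      also have "\<dots> \<le> 2 ^ (Suc k * Suc k) * (x / (real N + 1)) ^ Suc k"
        using x by (intro mult_right_mono power_increasing) auto
      finally show "x / (real N + 1) * (2 ^ (k * k) * (x / real N) ^ k) \<le>
          2 ^ (Suc k * Suc k) * (x / (real N + 1)) ^ Suc k" .
    qed (use x in auto)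
    finally show ?thesis
      using \<open>degree q \<le> N\<close> by blast
  qed
  with f_bdd show ?case
    by blast
qed

section \<open>Complex functions and the norms of the statement\<close>

lemma legendre_partial_sum_eq:
  fixes F :: "real \<Rightarrow> real \<Rightarrow> complex"
  assumes "ess_bdd x (\<lambda>t. Re (F x t))" "ess_bdd x (\<lambda>t. Im (F x t))"
  shows "legendre_partial_sum F N x t =
    Complex (poly (lproj x N (\<lambda>t. Re (F x t))) (t / x)) (poly (lproj x N (\<lambda>t. Im (F x t))) (t / x))"
proof -
  \<comment> \<open>Legendre polynomials are real, so pairing with them acts separately on real and
    imaginary parts.\<close>
  have *: "integral {-x..x} (\<lambda>t. F x t * of_real (poly q (t / x))) =
      Complex (ip x (\<lambda>t. Re (F x t)) q) (ip x (\<lambda>t. Im (F x t)) q)" for q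
  proof -
    have "((\<lambda>t. of_real (Re (F x t) * poly q (t / x)) + \<i> * of_real (Im (F x t) * poly q (t / x)))
        has_integral of_real (ip x (\<lambda>t. Re (F x t)) q) + \<i> * of_real (ip x (\<lambda>t. Im (F x t)) q)) {-x..x}"
      unfolding ip_def
      by (intro has_integral_add has_integral_mult_right has_integral_of_real
            has_integral_integral_lebesgue_on ip_integrable assms) auto
    moreover have "of_real (Re (F x t) * poly q (t / x)) + \<i> * of_real (Im (F x t) * poly q (t / x)) =
        F x t * of_real (poly q (t / x))" for t
      by (simp add: complex_eq_iff)
    ultimately show ?thesis
      by (simp add: integral_unique Complex_eq)
  qed
  have "legendre_coeff F j x / of_real x =
      Complex (lcoef x (\<lambda>t. Re (F x t)) j) (lcoef x (\<lambda>t. Im (F x t)) j)" for j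
    by (simp add: legendre_coeff_def * lcoef_def complex_eq_iff)
  then show ?thesis
    unfolding legendre_partial_sum_def lproj_def
    by (simp only:) (simp add: poly_sum complex_eq_iff)
qed

lemma L2_norm_le:
  assumes "integrable (lebesgue_on {a..b}) (\<lambda>t. (norm (f t))\<^sup>2)"
    and "(LINT t|lebesgue_on {a..b}. (norm (f t))\<^sup>2) \<le> B\<^sup>2" "0 \<le> B"
  shows "L2_norm a b f \<le> ennreal B"
proof -
  have "(\<integral>\<^sup>+t. ennreal ((norm (f t))\<^sup>2) \<partial>lebesgue_on {a..b}) =
      ennreal (LINT t|lebesgue_on {a..b}. (norm (f t))\<^sup>2)"
    using assms(1) by (intro nn_integral_eq_integral) auto
  moreover have "sqrt (LINT t|lebesgue_on {a..b}. (norm (f t))\<^sup>2) \<le> B"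
    using assms(2,3) by (intro real_le_lsqrt) auto
  ultimately show ?thesis
    by (simp add: L2_norm_def ennreal_leI)
qed

lemma legendre_partial_sum_error:
  fixes F :: "real \<Rightarrow> real \<Rightarrow> complex"
  assumes x: "x > 0" and F: "nth_weak_deriv k (-x) x (F x) g" and N: "k \<le> N" "0 < N"
  shows "L2_norm (-x) x (\<lambda>t. F x t - legendre_partial_sum F N x t) \<le>
    ennreal (2 ^ (k * k + 1) * x powr (real k + 1 / 2) / real N ^ k) * Linf_norm (-x) x g"
proof (cases "Linf_norm (-x) x g")
  case top
  \<comment> \<open>The constant is positive, so the right-hand side is infinite.\<close>
  then show ?thesis
    using x N by (simp add: ennreal_mult_top)
next
  case (real m)
  have "AE t in lebesgue_on {-x..x}. ennreal (norm (g t)) \<le> ennreal m"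
    using esssup_AE[where M = "lebesgue_on {-x..x}" and f = "\<lambda>t. ennreal (norm (g t))"] real
    by (simp add: Linf_norm_def)
  then have g: "AE t in lebesgue_on {-x..x}. norm (g t) \<le> m"
    using \<open>0 \<le> m\<close> by simp
  let ?E = "(2 ^ (k * k) * (x / (real N + 1)) ^ k)\<^sup>2 * (2 * x * m\<^sup>2)"
  let ?Re = "\<lambda>t. Re (F x t)" and ?Im = "\<lambda>t. Im (F x t)"
  have Re: "ess_bdd x ?Re" "sqerr x ?Re (lproj x N ?Re) \<le> ?E"
    using weak_deriv_poly_approx[OF bounded_linear_Re abs_Re_le_cmod x F g] N(1) sqerr_lproj_le[OF x]
    by (blast intro: order.trans)+
  have Im: "ess_bdd x ?Im" "sqerr x ?Im (lproj x N ?Im) \<le> ?E"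
    using weak_deriv_poly_approx[OF bounded_linear_Im abs_Im_le_cmod x F g] N(1) sqerr_lproj_le[OF x]
    by (blast intro: order.trans)+
  let ?R = "\<lambda>t. ?Re t - poly (lproj x N ?Re) (t / x)" and ?I = "\<lambda>t. ?Im t - poly (lproj x N ?Im) (t / x)"
  have eq: "F x t - legendre_partial_sum F N x t = Complex (?R t) (?I t)" for t
    by (simp add: legendre_partial_sum_eq Re Im complex_eq_iff)
  have bdd: "ess_bdd x ?R" "ess_bdd x ?I"
    by (intro ess_bdd_diff ess_bdd_poly Re Im)+
  have int: "integrable (lebesgue_on {-x..x}) (\<lambda>t. (?R t)\<^sup>2)" "integrable (lebesgue_on {-x..x}) (\<lambda>t. (?I t)\<^sup>2)"
    unfolding power2_eq_square by (intro ess_bdd_integrable ess_bdd_mult bdd)+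
  \<comment> \<open>Chosen so that \<open>?B\<close> squared is \<open>?E + ?E\<close>, the sum of
    the bounds for the real and the imaginary part.\<close>
  let ?B = "2 ^ (k * k + 1) * (x / (real N + 1)) ^ k * sqrt x * m"
  have norm: "(norm (Complex a b))\<^sup>2 = a\<^sup>2 + b\<^sup>2" for a b
    by (simp add: cmod_def)
  have "L2_norm (-x) x (\<lambda>t. F x t - legendre_partial_sum F N x t) \<le> ennreal ?B"
    unfolding eq
  proof (rule L2_norm_le)
    show "integrable (lebesgue_on {-x..x}) (\<lambda>t. (norm (Complex (?R t) (?I t)))\<^sup>2)"
      unfolding norm by (intro Bochner_Integration.integrable_add int)
    have "(LINT t|lebesgue_on {-x..x}. (norm (Complex (?R t) (?I t)))\<^sup>2) =
        sqerr x ?Re (lproj x N ?Re) + sqerr x ?Im (lproj x N ?Im)"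
      unfolding norm sqerr_def by (intro Bochner_Integration.integral_add int)
    also have "\<dots> \<le> ?E + ?E"
      using Re(2) Im(2) by (rule add_mono)
    also have "\<dots> = ?B\<^sup>2"
      using x by (simp add: power_mult_distrib power_add)
    finally show "(LINT t|lebesgue_on {-x..x}. (norm (Complex (?R t) (?I t)))\<^sup>2) \<le> ?B\<^sup>2" .
  qed (use x \<open>0 \<le> m\<close> in auto)
  also have "?B \<le> 2 ^ (k * k + 1) * x powr (real k + 1 / 2) / real N ^ k * m"
  proof -
    have "(x / (real N + 1)) ^ k \<le> (x / real N) ^ k"
      using x N(2) by (intro power_mono divide_left_mono) auto
    then have "?B \<le> 2 ^ (k * k + 1) * (x / real N) ^ k * sqrt x * m"
      using x \<open>0 \<le> m\<close> by (intro mult_right_mono mult_left_mono) auto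
    also have "\<dots> = 2 ^ (k * k + 1) * x powr (real k + 1 / 2) / real N ^ k * m"
      using x by (simp add: power_divide powr_add powr_realpow powr_half_sqrt)
    finally show ?thesis .
  qed
  then have "ennreal ?B \<le> ennreal (2 ^ (k * k + 1) * x powr (real k + 1 / 2) / real N ^ k * m)"
    by (rule ennreal_leI)
  also have "\<dots> = ennreal (2 ^ (k * k + 1) * x powr (real k + 1 / 2) / real N ^ k) * Linf_norm (-x) x g"
    using real by (simp only: ennreal_mult'')
  finally show ?thesis .
qed

lemma legendre_partial_sum_error_sup:
  fixes F :: "real \<Rightarrow> real \<Rightarrow> complex"
  assumes x: "x \<in> {0<..b}" and N: "k \<le> N" "0 < N"
  shows "L2_norm (-x) x (\<lambda>t. F x t - legendre_partial_sum F N x t) \<le>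
    ennreal (2 ^ (k * k + 1) * x powr (real k + 1 / 2) / real N ^ k) * sup_dt_Linf_norm k b F"
proof -
  define c where "c = ennreal (2 ^ (k * k + 1) * x powr (real k + 1 / 2) / real N ^ k)"
  let ?L = "L2_norm (-x) x (\<lambda>t. F x t - legendre_partial_sum F N x t)"
  have c: "0 < c" "c < top"
    using x N by (simp_all add: c_def)
  \<comment> \<open>Dividing by the positive constant turns the bounds for the single
    \<open>g\<close> into a lower bound for the infimum; with no such \<open>g\<close> the infimum
    is infinite.\<close>
  have "?L / c \<le> deriv_Linf_norm k (-x) x (F x)"
    unfolding deriv_Linf_norm_def
    using legendre_partial_sum_error[of x k F _ N] x N c(1)
    by (intro INF_greatest divide_le_posI_ennreal) (auto simp: c_def)
  also have "\<dots> \<le> sup_dt_Linf_norm k b F"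
    unfolding sup_dt_Linf_norm_def using x by (rule SUP_upper)
  finally have "c * (?L / c) \<le> c * sup_dt_Linf_norm k b F"
    by (rule mult_left_mono) simp
  moreover have "c * (?L / c) = ?L"
    using c mult_divide_eq_ennreal[of c ?L] by (simp add: ennreal_times_divide mult.commute)
  ultimately show ?thesis
    by (simp add: c_def)
qed

theorem propositionA2:
  fixes p :: nat
  shows "\<exists>c d :: real. \<forall>b > 0. \<forall>Q h K.
     Q \<in> W_inf p 0 b \<longrightarrow> transmutation_kernel b Q h K \<longrightarrow>
     (let K1 = kernel_dx b K;
          M = sup_dt_Linf_norm (p + 1) b K;
          M1 = sup_dt_Linf_norm p b K1
      in \<forall>x\<in>{0<..b}.
           (\<forall>N\<ge>p + 2.
              L2_norm (-x) x (\<lambda>t. K x t - legendre_partial_sum K N x t)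
                \<le> ennreal (c * x powr (real p + 3 / 2) / real N ^ (p + 1)) * M) \<and>
           (\<forall>N\<ge>p + 1.
              L2_norm (-x) x (\<lambda>t. K1 x t - legendre_partial_sum K1 N x t)
                \<le> ennreal (d * x powr (real p + 1 / 2) / real N ^ p) * M1))"
proof (intro exI allI impI, unfold Let_def, intro ballI conjI allI impI)
  fix b x :: real and Q h K and N :: nat
  assume "x \<in> {0<..b}" "p + 2 \<le> N"
  \<comment> \<open>The general constant at k = p + 1, where k + 1 / 2 is p + 3 / 2.\<close>
  then show "L2_norm (-x) x (\<lambda>t. K x t - legendre_partial_sum K N x t) \<le>
      ennreal (2 ^ ((p + 1) * (p + 1) + 1) * x powr (real p + 3 / 2) / real N ^ (p + 1)) *
      sup_dt_Linf_norm (p + 1) b K"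
    using legendre_partial_sum_error_sup[of x b "p + 1" N K] by (simp add: add.assoc add.commute[of 1])
next
  fix b x :: real and Q h K and N :: nat
  assume "x \<in> {0<..b}" "p + 1 \<le> N"
  \<comment> \<open>The general constant at k = p; the bound p + 1 \<le> N gives 0 < N also when p =
    0.\<close>
  then show "L2_norm (-x) x (\<lambda>t. kernel_dx b K x t - legendre_partial_sum (kernel_dx b K) N x t) \<le>
      ennreal (2 ^ (p * p + 1) * x powr (real p + 1 / 2) / real N ^ p) *
      sup_dt_Linf_norm p b (kernel_dx b K)"
    by (intro legendre_partial_sum_error_sup) auto
qed

end
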